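(* Let $n\ge2$, let $\mu\ge0$, and let $u:\mathbb{R}^n\to\mathbb{R}$ be $\mu$-panharmonic on the entire space $\mathbb{R}^n$. If $u$ is bounded, then $u$ is constant.
   Context: A function $u$ is $\mu$-panharmonic on a domain $D\subset\mathbb{R}^n$ if its second derivatives are continuous and it satisfies the Yukawa equation $\Delta u=\mu^2u$ on $D$. *)

theory Defs
  imports "HOL-Analysis.Analysis"
begin

definition partially_differentiable_at :: "'n::finite \<Rightarrow> (real ^ 'n \<Rightarrow> real) \<Rightarrow> real ^ 'n \<Rightarrow> bool"
  where "partially_differentiable_at i u x \<longleftrightarrow>
    (\<lambda>t. u (x + t *\<^sub>R axis i 1)) differentiable (at 0)"

(* deriv returns an arbitrary value where the derivative does not exist, so this is
   meaningful only together with partially_differentiable_at i u x. *)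
definition partial_deriv :: "'n::finite \<Rightarrow> (real ^ 'n \<Rightarrow> real) \<Rightarrow> real ^ 'n \<Rightarrow> real"
  where "partial_deriv i u x = deriv (\<lambda>t. u (x + t *\<^sub>R axis i 1)) 0"

(* On an open set this is the usual class C^2: existence and continuity of all (also mixed)
   second partial derivatives already forces u and its first partial derivatives to be
   continuous, so these are not listed separately. *)
definition C2_on :: "(real ^ 'n::finite \<Rightarrow> real) \<Rightarrow> (real ^ 'n) set \<Rightarrow> bool"
  where "C2_on u D \<longleftrightarrow>
    (\<forall>i. \<forall>x\<in>D. partially_differentiable_at i u x) \<and>
    (\<forall>i j. \<forall>x\<in>D. partially_differentiable_at i (partial_deriv j u) x) \<and>
    (\<forall>i j. continuous_on D (partial_deriv i (partial_deriv j u)))"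

definition laplacian :: "(real ^ 'n::finite \<Rightarrow> real) \<Rightarrow> real ^ 'n \<Rightarrow> real"
  where "laplacian u x = (\<Sum>i\<in>UNIV. partial_deriv i (partial_deriv i u) x)"

definition panharmonic_on :: "real \<Rightarrow> (real ^ 'n::finite \<Rightarrow> real) \<Rightarrow> (real ^ 'n) set \<Rightarrow> bool"
  where "panharmonic_on \<mu> u D \<longleftrightarrow>
    open D \<and> connected D \<and> D \<noteq> {} \<and>
    C2_on u D \<and> (\<forall>x\<in>D. laplacian u x = \<mu>\<^sup>2 * u x)"

end

theory Submission
  imports Defs
begin

text \<open>
  Let \<open>R\<close> be the reflection in a hyperplane \<open>x\<^sub>i = a\<close> and put \<open>v = u - u \<circ> R\<close>, which again solves the
  Yukawa equation, is bounded and vanishes on the hyperplane. In the slab \<open>0 \<le> s \<le> L\<close> with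
  \<open>s = x\<^sub>i - a\<close>, comparing \<open>v\<close> with the strictly superharmonic barrier
  \<open>K (2 L s - s\<^sup>2) + \<epsilon> \<bar>x\<bar>\<^sup>2\<close>, where \<open>K L\<^sup>2\<close> bounds \<open>v\<close>, gives \<open>v \<le> 2 K L s\<close> as \<open>\<epsilon> \<rightarrow> 0\<close>, and this
  tends to \<open>0\<close> as \<open>L \<rightarrow> \<infinity>\<close>. Hence \<open>u\<close> is invariant under all these reflections, so its value does
  not change when the coordinates of the argument are altered one at a time.
\<close>

section \<open>Calculus along the coordinate axes\<close>

text \<open>If \<open>D > 0\<close>, then \<open>g'\<close>, which vanishes at the maximum, is
  positive just to the right of \<open>t0\<close>, and the mean value theorem makes \<open>g\<close>
  exceed \<open>g t0\<close> there.\<close>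

lemma local_max_second_derivative_nonpos:
  fixes g g' :: "real \<Rightarrow> real"
  assumes g: "\<And>t. (g has_real_derivative g' t) (at t)"
    and g': "(g' has_real_derivative D) (at t0)"
    and max: "eventually (\<lambda>t. g t \<le> g t0) (at t0)"
  shows "D \<le> 0"
proof (rule ccontr)
  assume "\<not> D \<le> 0"
  then have "D > 0" by simp
  obtain d where d: "d > 0" "\<And>t. dist t t0 < d \<Longrightarrow> g t \<le> g t0"
    using max unfolding eventually_at by (metis UNIV_I order_refl)
  have z: "g' t0 = 0"
    by (rule DERIV_local_max[OF g d(1)]) (use d(2) in \<open>auto simp: dist_real_def abs_minus_commute\<close>)
  obtain e where e: "e > 0" "\<And>h. 0 < h \<Longrightarrow> h < e \<Longrightarrow> g' t0 < g' (t0 + h)"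
    using DERIV_pos_inc_right[OF g' \<open>D > 0\<close>] by blast
  define h where "h = min d e / 2"
  have h: "0 < h" "h < d" "h < e" using d e by (auto simp: h_def)
  obtain c where c: "t0 < c" "c < t0 + h" "g (t0 + h) - g t0 = (t0 + h - t0) * g' c"
    using MVT2[of t0 "t0 + h" g g'] g h by auto
  have "g' c > 0" using e(2)[of "c - t0"] c h z by simp
  then have "g (t0 + h) > g t0" using c h by (simp add: algebra_simps)
  moreover have "g (t0 + h) \<le> g t0" using d(2) h by (simp add: dist_real_def)
  ultimately show False by simp
qed

text \<open>The definitions differentiate only at parameter \<open>0\<close>; moving the base point
  along the line carries this to every \<open>t\<close>, as the mean value theorem and the chain
  rule require.\<close>

lemma has_real_derivative_along_axis:
  fixes f :: "real ^ 'n::finite \<Rightarrow> real"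
  assumes "\<And>x. partially_differentiable_at i f x"
  shows "((\<lambda>t. f (x + t *\<^sub>R axis i 1)) has_real_derivative
           partial_deriv i f (x + t *\<^sub>R axis i 1)) (at t)"
proof -
  let ?y = "x + t *\<^sub>R axis i 1"
  have "((\<lambda>s. f (?y + s *\<^sub>R axis i 1)) has_real_derivative partial_deriv i f ?y) (at 0)"
    using assms[of ?y] unfolding partially_differentiable_at_def partial_deriv_def
    by (simp add: DERIV_deriv_iff_real_differentiable)
  then have "((\<lambda>s. f (?y + (s + - t) *\<^sub>R axis i 1)) has_real_derivative partial_deriv i f ?y) (at t)"
    by (subst DERIV_shift[symmetric]) simp
  moreover have "?y + (s + - t) *\<^sub>R axis i 1 = x + s *\<^sub>R axis i 1" for s
    by (simp add: scaleR_left_diff_distrib)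
  ultimately show ?thesis by (simp only:)
qed

text \<open>Near \<open>x\<close> the partial derivatives are bounded on a compact cube, so the
  increment of \<open>f\<close> from \<open>x\<close> is at most a constant times the l1 distance.
  This recovers the continuity that \<open>C2_on\<close> leaves implicit.\<close>

lemma continuous_of_continuous_partials:
  fixes f :: "real ^ 'n::finite \<Rightarrow> real"
  assumes d: "\<And>i x t. ((\<lambda>t. f (x + t *\<^sub>R axis i 1)) has_real_derivative f' i (x + t *\<^sub>R axis i 1)) (at t)"
    and c: "\<And>i. continuous_on UNIV (f' i)"
  shows "continuous_on UNIV f"
proof -
  have "isCont f x" for x
  proof -
    let ?Q = "cbox (x - 1) (x + 1)"
    have "\<exists>B. \<forall>i. \<forall>z\<in>?Q. \<bar>f' i z\<bar> \<le> B"
    proof -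
      have "\<exists>B. \<forall>z\<in>?Q. \<bar>f' i z\<bar> \<le> B" for i
        using compact_imp_bounded[OF compact_continuous_image[OF continuous_on_subset[OF c] compact_cbox]]
        by (fastforce simp: bounded_iff)
      then obtain b where b: "\<And>i z. z \<in> ?Q \<Longrightarrow> \<bar>f' i z\<bar> \<le> b i" by metis
      have "b i \<le> Max (range b)" for i by simp
      then show ?thesis using b by (meson order_trans)
    qed
    then obtain B where B: "\<And>i z. z \<in> ?Q \<Longrightarrow> \<bar>f' i z\<bar> \<le> B" by blast
    have bound: "\<bar>f z - f x\<bar> \<le> B * (\<Sum>i\<in>UNIV. \<bar>z $ i - x $ i\<bar>)" if z: "z \<in> ?Q" for z
    proof -
      \<comment> \<open>A path from \<open>x\<close> to \<open>z\<close> that changes one coordinate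
        at a time. Each of its segments stays in the cube, so \<open>B\<close> bounds the derivative
        along it.\<close>
      define m where "m S = (\<chi> k. if k \<in> S then z $ k else x $ k)" for S
      have "\<bar>f (m S) - f x\<bar> \<le> B * (\<Sum>i\<in>S. \<bar>z $ i - x $ i\<bar>)" for S
        using finite[of S]
      proof (induction S rule: finite_induct)
        case empty
        then show ?case by (simp add: m_def)
      next
        case (insert i S)
        let ?h = "z $ i - x $ i"
        have m: "m (insert i S) = m S + ?h *\<^sub>R axis i 1"
          using insert by (auto simp: m_def vec_eq_iff axis_def)
        have Q: "m S + (t * ?h) *\<^sub>R axis i 1 \<in> ?Q" if "0 \<le> t" "t \<le> 1" for t
        proof -
          have "\<bar>t * ?h\<bar> \<le> \<bar>?h\<bar>" using that by (simp add: abs_mult mult_left_le_one_le)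
          also have "\<dots> \<le> 1" using z by (simp add: mem_box_cart abs_le_iff algebra_simps)
          finally have "\<bar>t * ?h\<bar> \<le> 1" .
          then show ?thesis
            using z insert(2) by (auto simp: mem_box_cart m_def axis_def abs_le_iff)
        qed
        have D: "((\<lambda>t. f (m S + (t * ?h) *\<^sub>R axis i 1)) has_real_derivative
             f' i (m S + (t * ?h) *\<^sub>R axis i 1) * ?h) (at t)" for t
          by (rule DERIV_chain2[OF d]) (auto intro!: derivative_eq_intros)
        obtain t where t: "0 < t" "t < 1"
          "f (m S + (1 * ?h) *\<^sub>R axis i 1) - f (m S + (0 * ?h) *\<^sub>R axis i 1)
             = (1 - 0) * (f' i (m S + (t * ?h) *\<^sub>R axis i 1) * ?h)"
          using MVT2[OF zero_less_one D] by blast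
        have "\<bar>f (m (insert i S)) - f (m S)\<bar> \<le> B * \<bar>?h\<bar>"
          using t B[OF Q[of t]] by (simp add: m abs_mult mult_right_mono)
        then show ?case using insert by (simp add: distrib_left)
      qed
      from this[of UNIV] show ?thesis by (simp add: m_def)
    qed
    have "x \<in> box (x - 1) (x + 1)" by (simp add: mem_box_cart)
    then have ev: "eventually (\<lambda>z. z \<in> box (x - 1) (x + 1)) (at x)"
      using open_box by (metis eventually_at_topological)
    have "((\<lambda>z. B * (\<Sum>i\<in>UNIV. \<bar>z $ i - x $ i\<bar>)) \<longlongrightarrow> B * (\<Sum>i\<in>UNIV. \<bar>x $ i - x $ i\<bar>)) (at x)"
      by (intro tendsto_intros)
    then have "((\<lambda>z. B * (\<Sum>i\<in>UNIV. \<bar>z $ i - x $ i\<bar>)) \<longlongrightarrow> 0) (at x)" by simp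
    moreover have "eventually (\<lambda>z. norm (f z - f x) \<le> B * (\<Sum>i\<in>UNIV. \<bar>z $ i - x $ i\<bar>)) (at x)"
      using ev by eventually_elim (use bound box_subset_cbox in auto)
    ultimately have "((\<lambda>z. f z - f x) \<longlongrightarrow> 0) (at x)"
      by (rule Lim_null_comparison[rotated])
    then show ?thesis by (simp add: isCont_def LIM_zero_iff)
  qed
  then show ?thesis by (simp add: continuous_at_imp_continuous_on)
qed

section \<open>Reflections and comparison in a slab\<close>

definition reflect :: "'n::finite \<Rightarrow> real \<Rightarrow> real ^ 'n \<Rightarrow> real ^ 'n"
  where "reflect i a x = (\<chi> k. if k = i then 2 * a - x $ k else x $ k)"

lemma continuous_on_reflect [continuous_intros]: "continuous_on S (reflect i a)"
proof -
  have "continuous_on S (\<lambda>x. if k = i then 2 * a - x $ k else x $ k)" for k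
    by (cases "k = i") (auto intro!: continuous_intros)
  then show ?thesis unfolding reflect_def by (intro continuous_on_vec_lambda)
qed

lemma reflect_along_axis:
  "reflect i a (x + t *\<^sub>R axis j 1) = reflect i a x + ((if j = i then -1 else 1) * t) *\<^sub>R axis j 1"
  by (auto simp: reflect_def vec_eq_iff axis_def)

text \<open>A positive maximum of \<open>w\<close> over the slab cut off by a large ball would be
  interior. There the second-derivative test contradicts the equation, since the barrier has
  Laplacian \<open>- 2 * K + 2 * \<epsilon> * CARD('n) < 0\<close>.\<close>

lemma slab_barrier:
  fixes u :: "real ^ 'n::finite \<Rightarrow> real" and K L M \<epsilon> a :: real
  assumes cont: "continuous_on UNIV u"
    and d1: "\<And>j x t. ((\<lambda>t. u (x + t *\<^sub>R axis j 1)) has_real_derivative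
                u' j (x + t *\<^sub>R axis j 1)) (at t)"
    and d2: "\<And>j x t. ((\<lambda>t. u' j (x + t *\<^sub>R axis j 1)) has_real_derivative
                u'' j (x + t *\<^sub>R axis j 1)) (at t)"
    and eq: "\<And>x. (\<Sum>j\<in>UNIV. u'' j x) = c * u x"
    and "c \<ge> 0"
    and bound: "\<And>x. \<bar>u x\<bar> \<le> M"
    and K: "2 * M \<le> K * L\<^sup>2" "K > 0"
    and \<epsilon>: "0 < \<epsilon>" "\<epsilon> * CARD('n) < K"
    and p: "a \<le> p $ i" "p $ i \<le> a + L"
  shows "u p - u (reflect i a p) \<le> K * (2 * L * (p $ i - a) - (p $ i - a)\<^sup>2) + \<epsilon> * (norm p)\<^sup>2"
proof (rule ccontr)
  define v where "v x = u x - u (reflect i a x)" for x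
  define b where "b x = K * (2 * L * (x $ i - a) - (x $ i - a)\<^sup>2)" for x :: "real ^ 'n"
  define w where "w x = v x - b x - \<epsilon> * (x \<bullet> x)" for x
  assume "\<not> ?thesis"
  then have wp: "w p > 0" by (simp add: w_def v_def b_def power2_norm_eq_inner)
  have v2: "v x \<le> 2 * M" for x
    using bound[of x] bound[of "reflect i a x"] by (simp add: v_def)
  \<comment> \<open>Large enough that the ball contains \<open>p\<close> and that the term
    \<open>\<epsilon> * (x \<bullet> x)\<close> exceeds the bound \<open>2 * M\<close> of
    \<open>v\<close> on the sphere.\<close>
  define r where "r = 1 + norm p + 2 * M / \<epsilon>"
  have "M \<ge> 0" using bound[of p] by linarith
  have r1: "r \<ge> 1" and rp: "norm p \<le> r" using \<open>M \<ge> 0\<close> \<epsilon> by (auto simp: r_def)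
  have "2 * M < \<epsilon> * r" using \<epsilon> \<open>M \<ge> 0\<close> by (simp add: r_def algebra_simps add_pos_nonneg)
  also have "\<dots> \<le> \<epsilon> * r\<^sup>2" using r1 \<epsilon> by (simp add: power2_eq_square)
  finally have rM: "2 * M < \<epsilon> * r\<^sup>2" .
  define S where "S = {x :: real ^ 'n. a \<le> x $ i} \<inter> {x. x $ i \<le> a + L} \<inter> cball 0 r"
  have "compact S"
    unfolding S_def
    by (intro closed_Int_compact closed_Int compact_cball closed_Collect_le continuous_intros)
  moreover have "p \<in> S" using p rp by (simp add: S_def)
  moreover have "continuous_on S w"
    unfolding w_def v_def b_def
    by (intro continuous_intros continuous_on_compose2[OF cont] subset_UNIV)
  ultimately obtain q where q: "q \<in> S" "\<And>x. x \<in> S \<Longrightarrow> w x \<le> w q"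
    using continuous_attains_sup[of S w] by blast
  have wq: "w q > 0" using q(2)[OF \<open>p \<in> S\<close>] wp by linarith
  have s: "0 \<le> q $ i - a" "q $ i - a \<le> L" using q(1) by (auto simp: S_def)
  \<comment> \<open>With \<open>s = q $ i - a\<close>, the barrier is
    \<open>K * s * (2 * L - s)\<close>, nonnegative in the slab; hence \<open>w q > 0\<close> forces
    \<open>v q > 0\<close>.\<close>
  have "(q $ i - a) * (q $ i - a) \<le> L * (q $ i - a)" using s by (intro mult_right_mono) auto
  moreover have "L * (q $ i - a) \<ge> 0" using s by auto
  ultimately have b0: "b q \<ge> 0" using K(2) by (simp add: b_def power2_eq_square)
  have qq: "\<epsilon> * (q \<bullet> q) \<ge> 0" using \<epsilon> by simp
  have vq: "v q > 0" using wq b0 qq by (simp add: w_def)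
  \<comment> \<open>The maximum avoids the boundary: \<open>v\<close> vanishes on the near face,
    while \<open>b\<close> on the far face and the quadratic term on the sphere are at least as
    large as \<open>v\<close>.\<close>
  have "q $ i \<noteq> a"
  proof
    assume "q $ i = a"
    then have "reflect i a q = q" by (simp add: reflect_def vec_eq_iff)
    then show False using vq by (simp add: v_def)
  qed
  moreover have "q $ i \<noteq> a + L"
  proof
    assume "q $ i = a + L"
    then have "b q = K * L\<^sup>2" by (simp add: b_def power2_eq_square)
    then show False using v2[of q] K wq qq by (simp add: w_def)
  qed
  moreover have "norm q < r"
  proof (rule ccontr)
    assume "\<not> norm q < r"
    then have "\<epsilon> * r\<^sup>2 \<le> \<epsilon> * (norm q)\<^sup>2" using r1 \<epsilon> by (intro mult_left_mono power_mono) auto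
    then show False using v2[of q] rM wq b0 by (simp add: w_def power2_norm_eq_inner)
  qed
  moreover define T where "T = {x :: real ^ 'n. a < x $ i} \<inter> {x. x $ i < a + L} \<inter> ball 0 r"
  ultimately have "q \<in> T" using s by (auto simp: T_def)
  have "open T"
    unfolding T_def by (intro open_Int open_ball open_Collect_less continuous_intros)
  have "T \<subseteq> S" by (auto simp: T_def S_def)
  have ineq: "u'' j q - u'' j (reflect i a q) + (if j = i then 2 * K else 0) - 2 * \<epsilon> \<le> 0" for j
  proof -
    let ?e = "axis j 1 :: real ^ 'n"
    \<comment> \<open>The reflection reverses only axis \<open>i\<close>. The sign
      \<open>\<sigma>\<close> enters the second derivative squared and drops out;
      \<open>\<delta>\<close> records that \<open>b\<close> varies only along axis
      \<open>i\<close>.\<close>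
    define \<sigma> :: real where "\<sigma> = (if j = i then -1 else 1)"
    define \<delta> :: real where "\<delta> = (if j = i then 1 else 0)"
    let ?q' = "reflect i a q"
    have si: "(q + t *\<^sub>R ?e) $ i = q $ i + \<delta> * t" for t by (simp add: axis_def \<delta>_def)
    have ni: "(q + t *\<^sub>R ?e) \<bullet> (q + t *\<^sub>R ?e) = q \<bullet> q + 2 * t * q $ j + t\<^sup>2" for t
      by (simp add: inner_add_left inner_add_right inner_axis inner_axis' inner_axis_axis power2_eq_square algebra_simps)
    define g where "g t = u (q + t *\<^sub>R ?e) - u (?q' + (\<sigma> * t) *\<^sub>R ?e)
      - K * (2 * L * (q $ i + \<delta> * t - a) - (q $ i + \<delta> * t - a)\<^sup>2)
      - \<epsilon> * (q \<bullet> q + 2 * t * q $ j + t\<^sup>2)" for t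
    have gw: "g t = w (q + t *\<^sub>R ?e)" for t
      unfolding w_def v_def b_def g_def reflect_along_axis si ni \<sigma>_def ..
    define g' where "g' t = u' j (q + t *\<^sub>R ?e) - u' j (?q' + (\<sigma> * t) *\<^sub>R ?e) * \<sigma>
      - K * (2 * L * \<delta> - 2 * (q $ i + \<delta> * t - a) * \<delta>) - \<epsilon> * (2 * q $ j + 2 * t)" for t
    have c1: "((\<lambda>t. u (?q' + (\<sigma> * t) *\<^sub>R ?e)) has_real_derivative u' j (?q' + (\<sigma> * t) *\<^sub>R ?e) * \<sigma>) (at t)" for t
      by (rule DERIV_chain2[OF d1]) (auto intro!: derivative_eq_intros)
    have c2: "((\<lambda>t. u' j (?q' + (\<sigma> * t) *\<^sub>R ?e)) has_real_derivative u'' j (?q' + (\<sigma> * t) *\<^sub>R ?e) * \<sigma>) (at t)" for t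
      by (rule DERIV_chain2[OF d2]) (auto intro!: derivative_eq_intros)
    have G: "(g has_real_derivative g' t) (at t)" for t
      unfolding g_def g'_def
      by (rule derivative_eq_intros d1 c1 refl | simp)+
    \<comment> \<open>The terms with \<open>0\<close> keep the shape in which \<open>d2\<close> and
      \<open>c2\<close> deliver the derivatives.\<close>
    have G': "(g' has_real_derivative
        (u'' j (q + 0 *\<^sub>R ?e) - u'' j (?q' + (\<sigma> * 0) *\<^sub>R ?e) * \<sigma> * \<sigma> + K * 2 * \<delta> * \<delta> - \<epsilon> * 2)) (at 0)"
      unfolding g'_def
      by (rule derivative_eq_intros d2 c2 refl | simp)+
    have "open ((\<lambda>t. q + t *\<^sub>R ?e) -` T)"
      by (intro open_vimage \<open>open T\<close> continuous_intros)
    moreover have "0 \<in> (\<lambda>t. q + t *\<^sub>R ?e) -` T" using \<open>q \<in> T\<close> by simp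
    ultimately have "eventually (\<lambda>t. t \<in> (\<lambda>t. q + t *\<^sub>R ?e) -` T) (at 0)"
      by (metis eventually_at_topological)
    then have "eventually (\<lambda>t. g t \<le> g 0) (at 0)"
      by eventually_elim (use q(2) \<open>T \<subseteq> S\<close> in \<open>auto simp: gw\<close>)
    from local_max_second_derivative_nonpos[OF G G' this] show ?thesis
      by (auto simp: \<sigma>_def \<delta>_def split: if_splits)
  qed
  \<comment> \<open>Summation over the axes restores the Laplacians, which the equation replaces by
    \<open>c * v q\<close>.\<close>
  have "(\<Sum>j\<in>UNIV. u'' j q - u'' j (reflect i a q) + (if j = i then 2 * K else 0) - 2 * \<epsilon>) \<le> 0"
    by (intro sum_nonpos ineq)
  then have "c * v q + 2 * K - 2 * (\<epsilon> * CARD('n)) \<le> 0"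
    by (simp add: sum_subtractf sum.distrib eq v_def algebra_simps)
  moreover have "c * v q \<ge> 0" using vq \<open>c \<ge> 0\<close> by simp
  ultimately show False using \<epsilon> by linarith
qed

text \<open>The barrier bound is used with \<open>K = M' / L\<^sup>2\<close>; first
  \<open>\<epsilon>\<close> tends to \<open>0\<close>, then \<open>L\<close> to infinity. Keeping
  the derivatives as parameters \<open>u'\<close> and \<open>u''\<close> allows a direct application
  to \<open>- u\<close>.\<close>

lemma le_reflect:
  fixes u :: "real ^ 'n::finite \<Rightarrow> real"
  assumes cont: "continuous_on UNIV u"
    and d1: "\<And>j x t. ((\<lambda>t. u (x + t *\<^sub>R axis j 1)) has_real_derivative
                u' j (x + t *\<^sub>R axis j 1)) (at t)"
    and d2: "\<And>j x t. ((\<lambda>t. u' j (x + t *\<^sub>R axis j 1)) has_real_derivative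
                u'' j (x + t *\<^sub>R axis j 1)) (at t)"
    and eq: "\<And>x. (\<Sum>j\<in>UNIV. u'' j x) = c * u x"
    and "c \<ge> 0"
    and bound: "\<And>x. \<bar>u x\<bar> \<le> M"
    and p: "a \<le> p $ i"
  shows "u p \<le> u (reflect i a p)"
proof -
  define s where "s = p $ i - a"
  \<comment> \<open>The summand \<open>1\<close> keeps \<open>K\<close> positive even when
    \<open>M = 0\<close>.\<close>
  define M' where "M' = 2 * M + 1"
  have "M' > 0" using bound[of p] by (simp add: M'_def)
  have est: "u p - u (reflect i a p) \<le> M' / L\<^sup>2 * (2 * L * s - s\<^sup>2)" if L: "L > 0" "L \<ge> s" for L
  proof (rule tendsto_lowerbound)
    show "((\<lambda>\<epsilon>. M' / L\<^sup>2 * (2 * L * s - s\<^sup>2) + \<epsilon> * (norm p)\<^sup>2) \<longlongrightarrow> M' / L\<^sup>2 * (2 * L * s - s\<^sup>2)) (at_right 0)"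
      by (auto intro!: tendsto_eq_intros)
    have "0 < M' / L\<^sup>2 / CARD('n)" using \<open>M' > 0\<close> L by simp
    then have "eventually (\<lambda>\<epsilon>. \<epsilon> \<in> {0<..<M' / L\<^sup>2 / CARD('n)}) (at_right 0)"
      by (rule eventually_at_right_real)
    then show "eventually (\<lambda>\<epsilon>. u p - u (reflect i a p) \<le>
        M' / L\<^sup>2 * (2 * L * s - s\<^sup>2) + \<epsilon> * (norm p)\<^sup>2) (at_right 0)"
    proof eventually_elim
      case (elim \<epsilon>)
      then have "\<epsilon> * CARD('n) < M' / L\<^sup>2" using pos_less_divide_eq[of "real CARD('n)" \<epsilon> "M' / L\<^sup>2"] by simp
      then show ?case
        unfolding s_def
        using elim p L \<open>M' > 0\<close>
        by (intro slab_barrier[OF cont d1 d2 eq \<open>c \<ge> 0\<close> bound]) (auto simp: M'_def s_def)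
    qed
  qed simp
  \<comment> \<open>For fixed \<open>s\<close> the estimate is a polynomial in
    \<open>inverse L\<close> without constant term.\<close>
  have "u p - u (reflect i a p) \<le> 0"
  proof (rule tendsto_lowerbound)
    have "((\<lambda>L. M' * (2 * s) * inverse L - M' * s\<^sup>2 * (inverse L)\<^sup>2) \<longlongrightarrow> M' * (2 * s) * 0 - M' * s\<^sup>2 * 0\<^sup>2) at_top"
      by (intro tendsto_intros tendsto_inverse_0_at_top filterlim_ident)
    then show "((\<lambda>L. M' * (2 * s) * inverse L - M' * s\<^sup>2 * (inverse L)\<^sup>2) \<longlongrightarrow> 0) at_top" by simp
    show "eventually (\<lambda>L. u p - u (reflect i a p) \<le> M' * (2 * s) * inverse L - M' * s\<^sup>2 * (inverse L)\<^sup>2) at_top"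
      using eventually_gt_at_top[of 0] eventually_ge_at_top[of s]
    proof eventually_elim
      case (elim L)
      then have "M' / L\<^sup>2 * (2 * L * s - s\<^sup>2) = M' * (2 * s) * inverse L - M' * s\<^sup>2 * (inverse L)\<^sup>2"
        by (simp add: field_simps power2_eq_square)
      then show ?case using est[of L] elim by simp
    qed
  qed simp
  then show ?thesis by simp
qed

section \<open>Liouville's theorem from reflection invariance\<close>

theorem corollary4p5:
  fixes u :: "real ^ 'n::finite \<Rightarrow> real" and \<mu> :: real
  assumes "CARD('n) \<ge> 2"
    and "\<mu> \<ge> 0"
    and "panharmonic_on \<mu> u UNIV"
    and "bounded (range u)"
  shows "u constant_on UNIV"
proof -
  have C2: "C2_on u UNIV" and eq: "\<And>x. laplacian u x = \<mu>\<^sup>2 * u x"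
    using assms(3) by (auto simp: panharmonic_on_def)
  let ?u' = "\<lambda>j. partial_deriv j u"
  let ?u'' = "\<lambda>j. partial_deriv j (partial_deriv j u)"
  have d1: "((\<lambda>t. u (x + t *\<^sub>R axis j 1)) has_real_derivative ?u' j (x + t *\<^sub>R axis j 1)) (at t)" for j x t
    using C2 by (intro has_real_derivative_along_axis) (auto simp: C2_on_def)
  have d2: "((\<lambda>t. ?u' j (x + t *\<^sub>R axis k 1)) has_real_derivative
      partial_deriv k (?u' j) (x + t *\<^sub>R axis k 1)) (at t)" for j k x t
    using C2 by (intro has_real_derivative_along_axis) (auto simp: C2_on_def)
  \<comment> \<open>Continuity descends from the second partial derivatives, mixed ones included, to
    the first and then to \<open>u\<close>.\<close>
  have "continuous_on UNIV (?u' j)" for j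
    using C2 by (intro continuous_of_continuous_partials[OF d2]) (auto simp: C2_on_def)
  then have cont: "continuous_on UNIV u"
    by (rule continuous_of_continuous_partials[OF d1])
  obtain M where M: "\<And>x. \<bar>u x\<bar> \<le> M"
    using assms(4) by (auto simp: bounded_iff)
  have le: "u p \<le> u (reflect i a p)" if "a \<le> p $ i" for i a p
    using le_reflect[OF cont d1 d2 _ _ M that, of "\<mu>\<^sup>2"] eq by (simp add: laplacian_def)
  have ge: "u p \<ge> u (reflect i a p)" if "a \<le> p $ i" for i a p
  proof -
    have "- u p \<le> - u (reflect i a p)"
    proof (rule le_reflect[where u = "\<lambda>x. - u x" and u' = "\<lambda>j x. - ?u' j x"
          and u'' = "\<lambda>j x. - ?u'' j x" and c = "\<mu>\<^sup>2" and M = M])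
      show "(\<Sum>j\<in>UNIV. - ?u'' j x) = \<mu>\<^sup>2 * - u x" for x
        using eq[of x] by (simp add: laplacian_def sum_negf)
    qed (use M that in \<open>auto intro!: continuous_intros cont DERIV_minus d1 d2\<close>)
    then show ?thesis by simp
  qed
  have invol: "reflect i a (reflect i a p) = p" for i a and p :: "real ^ 'n"
    by (simp add: reflect_def vec_eq_iff)
  have sym: "u (reflect i a p) = u p" for i a p
  proof (cases "a \<le> p $ i")
    case True
    then show ?thesis using le ge by (intro antisym)
  next
    case False
    \<comment> \<open>A point on the other side is the mirror image of one already treated.\<close>
    then have "a \<le> reflect i a p $ i" by (simp add: reflect_def)
    then show ?thesis using le[of a "reflect i a p" i] ge[of a "reflect i a p" i] by (simp add: invol)
  qed
  have "u x = u 0" for x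
  proof -
    \<comment> \<open>A path from \<open>0\<close> to \<open>x\<close> through the coordinates:
      changing coordinate \<open>i\<close> from \<open>0\<close> to \<open>x $ i\<close> is the
      reflection about the midpoint \<open>x $ i / 2\<close>.\<close>
    define m where "m S = (\<chi> k. if k \<in> S then x $ k else 0)" for S
    have "u (m S) = u 0" for S
      using finite[of S]
    proof (induction S rule: finite_induct)
      case empty
      then show ?case by (simp add: m_def zero_vec_def)
    next
      case (insert i S)
      then have "m (insert i S) = reflect i (x $ i / 2) (m S)"
        by (auto simp: m_def reflect_def vec_eq_iff)
      then show ?case using insert.IH sym by simp
    qed
    from this[of UNIV] show ?thesis by (simp add: m_def)
  qed
  then show ?thesis by (auto simp: constant_on_def)
qed

end
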